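(* For all integers $n\geq 2$, we have $$|S_n^{(2)}(123:132)|=|S_n^{(2)}(132:312)|=2^{n-1}.$$
   Context: $S_n$ denotes the set of permutations $p=p(1)p(2)\cdots p(n)$ of $\{1,2,\ldots,n\}$ in one-line notation. For $p\in S_n$ and $q\in S_m$, $p$ contains $q$ as a pattern if there exist $1\leq i_1<\cdots<i_m\leq n$ such that for all $1\leq a<b\leq m$, $p(i_a)<p(i_b)$ if and only if $q(a)<q(b)$; otherwise $p$ avoids $q$. For $p\in S_n$ with $n\geq 2$, $p^{(2)}=p(2)p(3)\cdots p(n)p(1)$. For $q_1,q_2\in S_3$, $S_n^{(2)}(q_1:q_2)$ is the set of $p\in S_n$ such that $p$ avoids $q_1$ and $p^{(2)}$ avoids $q_2$. *)

theory Defs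
  imports "HOL-Combinatorics.Multiset_Permutations"
begin

text \<open>
  Permutations of \<open>{1..n}\<close> are represented by their one-line notation
  \<open>[p(1), \<dots>, p(n)]\<close>. The list is indexed from \<open>0\<close>, so \<open>p(i)\<close> is \<open>p ! (i - 1)\<close>.
\<close>

definition perms :: "nat \<Rightarrow> nat list set" where
  "perms n = permutations_of_set {1..n}"

definition contains_pattern :: "nat list \<Rightarrow> nat list \<Rightarrow> bool" where
  "contains_pattern p q \<longleftrightarrow>
     (\<exists>i :: nat \<Rightarrow> nat.
        strict_mono_on {..<length q} i \<and>
        (\<forall>a<length q. i a < length p) \<and>
        (\<forall>a b. a < b \<and> b < length q \<longrightarrow> (p ! i a < p ! i b \<longleftrightarrow> q ! a < q ! b)))"

definition avoids :: "nat list \<Rightarrow> nat list \<Rightarrow> bool" where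
  "avoids p q \<longleftrightarrow> \<not> contains_pattern p q"

text \<open>
  \<open>rotate1\<close> sends \<open>p(1)p(2)\<dots>p(n)\<close> to \<open>p(2)\<dots>p(n)p(1)\<close>, which is \<open>p\<^sup>(\<^sup>2\<^sup>)\<close>.
\<close>

definition avoid_pair :: "nat \<Rightarrow> nat list \<Rightarrow> nat list \<Rightarrow> nat list set" where
  "avoid_pair n q1 q2 = {p \<in> perms n. avoids p q1 \<and> avoids (rotate1 p) q2}"

end

theory Submission
  imports Defs
begin

text \<open>
  Write \<open>p = k w\<close>, so that \<open>p\<^sup>(\<^sup>2\<^sup>) = w k\<close>. For the pair 123, 132, the triples that involve \<open>k\<close>
  force the entries of \<open>w\<close> above \<open>k\<close> to be decreasing and to precede the entries below \<open>k\<close>; the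
  latter form an arbitrary permutation that avoids 123 and 132. For the pair 132, 312, the entries
  above \<open>k\<close> are increasing and follow the entries below \<open>k\<close>, which form an arbitrary permutation
  that avoids 132 and 312. In both cases there are \<open>2\<^sup>m\<^sup>-\<^sup>1\<close> permutations of \<open>m > 0\<close> values that
  avoid the two patterns, because one end entry has exactly two possible values and the remaining
  entries are constrained only among themselves. Hence the count is
  \<open>1 + 1 + 2 + \<dots> + 2\<^sup>n\<^sup>-\<^sup>2 = 2\<^sup>n\<^sup>-\<^sup>1\<close>.
\<close>

section \<open>Conditions on all triples of entries taken in list order\<close>

fun triples :: "('a \<Rightarrow> 'a \<Rightarrow> 'a \<Rightarrow> bool) \<Rightarrow> 'a list \<Rightarrow> bool" where
  "triples R [] \<longleftrightarrow> True"
| "triples R (x # xs) \<longleftrightarrow> sorted_wrt (R x) xs \<and> triples R xs"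

lemma triples_iff_nth:
  "triples R xs \<longleftrightarrow>
     (\<forall>i j k. i < j \<longrightarrow> j < k \<longrightarrow> k < length xs \<longrightarrow> R (xs ! i) (xs ! j) (xs ! k))"
proof (induction xs)
  case (Cons x xs)
  have "(\<forall>i j k. i < j \<longrightarrow> j < k \<longrightarrow> k < length (x # xs) \<longrightarrow>
           R ((x # xs) ! i) ((x # xs) ! j) ((x # xs) ! k)) \<longleftrightarrow>
        (\<forall>j k. j < k \<longrightarrow> k < length xs \<longrightarrow> R x (xs ! j) (xs ! k)) \<and>
        (\<forall>i j k. i < j \<longrightarrow> j < k \<longrightarrow> k < length xs \<longrightarrow> R (xs ! i) (xs ! j) (xs ! k))"
    (is "?L \<longleftrightarrow> ?A \<and> ?B")
  proof (intro iffI conjI)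
    assume L: ?L
    show ?A
      using L[rule_format, of 0 "Suc j" "Suc k" for j k] by auto
    show ?B
      using L[rule_format, of "Suc i" "Suc j" "Suc k" for i j k] by auto
  next
    assume AB: "?A \<and> ?B"
    show ?L
    proof (intro allI impI)
      fix i j k
      assume "i < j" "j < k" "k < length (x # xs)"
      moreover from this obtain j' k' where "j = Suc j'" "k = Suc k'"
        by (metis gr0_implies_Suc less_nat_zero_code neq0_conv)
      ultimately show "R ((x # xs) ! i) ((x # xs) ! j) ((x # xs) ! k)"
        using AB by (cases i) auto
    qed
  qed
  then show ?case
    using Cons.IH by (simp add: sorted_wrt_iff_nth_less)
qed simp

text \<open>Triples are sorted by how many of their entries lie in \<open>xs\<close>: three, none,
  one or two. When \<open>ys\<close> is \<open>[k]\<close>, the last conjunct is exactly the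
  condition on triples that end in \<open>k\<close>.\<close>

lemma triples_append:
  "triples R (xs @ ys) \<longleftrightarrow> triples R xs \<and> triples R ys \<and>
     (\<forall>x\<in>set xs. sorted_wrt (R x) ys) \<and> (\<forall>z\<in>set ys. sorted_wrt (\<lambda>x y. R x y z) xs)"
  by (induction xs) (auto simp: sorted_wrt_append)

lemma triples_rev: "triples R (rev xs) \<longleftrightarrow> triples (\<lambda>x y z. R z y x) xs"
  by (induction xs) (auto simp: triples_append sorted_wrt_rev)

lemma sorted_wrt_conj:
  "sorted_wrt (\<lambda>x y. P x y \<and> Q x y) xs \<longleftrightarrow> sorted_wrt P xs \<and> sorted_wrt Q xs"
  by (induction xs) auto

lemma triples_conj:
  "triples (\<lambda>x y z. R x y z \<and> S x y z) xs \<longleftrightarrow> triples R xs \<and> triples S xs"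
  by (induction xs) (auto simp: sorted_wrt_conj)

lemma all_sorted_wrt_trivial:
  assumes "\<And>x y. x \<in> set xs \<Longrightarrow> y \<in> set xs \<Longrightarrow> P x y"
  shows "sorted_wrt P xs"
  using assms by (induction xs) auto

lemma triples_mono:
  assumes "triples R xs"
    and "\<And>x y z. x \<in> set xs \<Longrightarrow> y \<in> set xs \<Longrightarrow> z \<in> set xs \<Longrightarrow> R x y z \<Longrightarrow> S x y z"
  shows "triples S xs"
  using assms
proof (induction xs)
  case (Cons x xs)
  have "sorted_wrt (S x) xs"
    by (rule sorted_wrt_mono_rel[of _ "R x"]) (use Cons.prems in auto)
  with Cons show ?case by auto
qed simp

section \<open>Patterns of length three as conditions on triples\<close>

definition order_iso3 :: "nat \<Rightarrow> nat \<Rightarrow> nat \<Rightarrow> nat \<Rightarrow> nat \<Rightarrow> nat \<Rightarrow> bool" where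
  "order_iso3 a b c x y z \<longleftrightarrow> (x < y \<longleftrightarrow> a < b) \<and> (x < z \<longleftrightarrow> a < c) \<and> (y < z \<longleftrightarrow> b < c)"

lemma avoids_iff_triples:
  "avoids p [a, b, c] \<longleftrightarrow> triples (\<lambda>x y z. \<not> order_iso3 a b c x y z) p"
proof -
  have "contains_pattern p [a, b, c] \<longleftrightarrow>
    (\<exists>i j k. i < j \<and> j < k \<and> k < length p \<and> order_iso3 a b c (p ! i) (p ! j) (p ! k))"
    (is "_ \<longleftrightarrow> ?R")
  proof
    assume "contains_pattern p [a, b, c]"
    then obtain f where f: "strict_mono_on {..<3::nat} f" "\<forall>m<3. f m < length p"
      and iso: "\<forall>m l. m < l \<and> l < 3 \<longrightarrow> (p ! f m < p ! f l \<longleftrightarrow> [a, b, c] ! m < [a, b, c] ! l)"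
      by (auto simp: contains_pattern_def eval_nat_numeral)
    have "f 0 < f 1" "f 1 < f 2"
      by (rule strict_mono_onD[OF f(1)]; simp)+
    moreover have "order_iso3 a b c (p ! f 0) (p ! f 1) (p ! f 2)"
      using iso[rule_format, of 0 1] iso[rule_format, of 0 2] iso[rule_format, of 1 2]
      by (simp add: order_iso3_def)
    ultimately show ?R
      using f(2) by (intro exI[of _ "f 0"] exI[of _ "f 1"] exI[of _ "f 2"]) auto
  next
    assume ?R
    then obtain i j k where ijk: "i < j" "j < k" "k < length p"
      and iso: "order_iso3 a b c (p ! i) (p ! j) (p ! k)"
      by blast
    have lt3: "m < 3 \<longleftrightarrow> m = 0 \<or> m = 1 \<or> m = 2" for m :: nat
      by auto
    show "contains_pattern p [a, b, c]"
      unfolding contains_pattern_def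
      \<comment> \<open>Only the arguments 0, 1, 2 of the index map matter, so list lookup in
        \<open>[i, j, k]\<close> serves as the witness.\<close>
      by (rule exI[of _ "\<lambda>m. [i, j, k] ! m"])
        (use ijk iso in \<open>auto simp: strict_mono_on_def lt3 order_iso3_def less_Suc_eq
           numeral_2_eq_2\<close>)
  qed
  then show ?thesis
    by (auto simp: avoids_def triples_iff_nth)
qed

lemma avoids_123_iff: "avoids p [1, 2, 3] \<longleftrightarrow> triples (\<lambda>x y z. \<not> (x < y \<and> y < z)) p"
  unfolding avoids_iff_triples
  by (rule arg_cong[of _ _ "\<lambda>R. triples R p"]) (auto simp: order_iso3_def fun_eq_iff)

text \<open>Containment compares entries by \<open><\<close> only, so a descent of the pattern turns
  into \<open>\<le>\<close>; the third comparison, x < y, then follows by transitivity.\<close>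

lemma avoids_132_iff: "avoids p [1, 3, 2] \<longleftrightarrow> triples (\<lambda>x y z. \<not> (x < z \<and> z \<le> y)) p"
  unfolding avoids_iff_triples
  by (rule arg_cong[of _ _ "\<lambda>R. triples R p"]) (auto simp: order_iso3_def fun_eq_iff)

lemma avoids_312_iff: "avoids p [3, 1, 2] \<longleftrightarrow> triples (\<lambda>x y z. \<not> (y < z \<and> z \<le> x)) p"
  unfolding avoids_iff_triples
  by (rule arg_cong[of _ _ "\<lambda>R. triples R p"]) (auto simp: order_iso3_def fun_eq_iff)

lemmas avoids_iffs = avoids_123_iff avoids_132_iff avoids_312_iff

section \<open>Counting words when every set of values admits exactly two heads\<close>

lemma card_permutations_two_heads:
  fixes A :: "'a set"
  assumes "finite A"
    and nil: "Q []" and single: "\<And>x. Q [x]"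
    and heads: "\<And>A. finite A \<Longrightarrow> card A \<ge> 2 \<Longrightarrow> \<exists>a\<in>A. \<exists>b\<in>A. a \<noteq> b \<and>
      (\<forall>x\<in>A. \<forall>xs\<in>permutations_of_set (A - {x}). Q (x # xs) \<longleftrightarrow> (x = a \<or> x = b) \<and> Q xs)"
  shows "card {xs \<in> permutations_of_set A. Q xs} = 2 ^ (card A - 1)"
  using \<open>finite A\<close>
\<comment> \<open>Each of the two admissible heads leaves the same problem on a set with one element
  fewer, so every element beyond the first doubles the count.\<close>
proof (induction "card A" arbitrary: A rule: less_induct)
  case less
  let ?F = "\<lambda>A. {xs \<in> permutations_of_set A. Q xs}"
  consider "card A = 0" | "card A = 1" | "card A \<ge> 2"
    by linarith
  then show ?case
  proof cases
    case 1
    \<comment> \<open>Truncated subtraction makes the exponent 0 here, which matches the single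
      empty word.\<close>
    then have "A = {}"
      using less.prems by simp
    moreover have "?F {} = {[]}"
      using nil by auto
    ultimately show ?thesis by simp
  next
    case 2
    then obtain x where "A = {x}"
      using card_1_singletonE by blast
    moreover have "?F {x} = {[x]}"
      using single by (auto simp: permutations_of_set_nonempty)
    ultimately show ?thesis by simp
  next
    case 3
    obtain a b where ab: "a \<in> A" "b \<in> A" "a \<noteq> b"
      and Q: "\<And>x xs. x \<in> A \<Longrightarrow> xs \<in> permutations_of_set (A - {x}) \<Longrightarrow>
        Q (x # xs) \<longleftrightarrow> (x = a \<or> x = b) \<and> Q xs"
      using heads[OF less.prems 3] by blast
    have split: "?F A = (#) a ` ?F (A - {a}) \<union> (#) b ` ?F (A - {b})"
    proof -
      have "permutations_of_set A = (\<Union>x\<in>A. (#) x ` permutations_of_set (A - {x}))"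
        using ab by (intro permutations_of_set_nonempty) auto
      then have "?F A = {xs \<in> (\<Union>x\<in>A. (#) x ` permutations_of_set (A - {x})). Q xs}"
        by (simp only:)
      also have "\<dots> = (\<Union>x\<in>A. (#) x ` {xs \<in> permutations_of_set (A - {x}). Q (x # xs)})"
        by blast
      also have "\<dots> = (\<Union>x\<in>A. (#) x `
          {xs \<in> permutations_of_set (A - {x}). (x = a \<or> x = b) \<and> Q xs})"
        using Q by (intro SUP_cong refl arg_cong[of _ _ "(`) _"] Collect_cong) blast
      also have "\<dots> = (#) a ` ?F (A - {a}) \<union> (#) b ` ?F (A - {b})"
        using ab(1,2) by blast
      finally show ?thesis .
    qed
    have rec: "card ((#) x ` ?F (A - {x})) = 2 ^ (card A - 2)" if "x \<in> A" for x
    proof -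
      have "card (A - {x}) = card A - 1"
        using that less.prems by simp
      moreover have "card (?F (A - {x})) = 2 ^ (card (A - {x}) - 1)"
        using 3 less.prems calculation by (intro less.hyps) auto
      ultimately show ?thesis
        by (simp add: card_image diff_diff_eq numeral_2_eq_2)
    qed
    have "card (?F A) = 2 ^ (card A - 2) + 2 ^ (card A - 2)"
      unfolding split using ab rec
      by (subst card_Un_disjoint) (auto simp: less.prems)
    also have "\<dots> = 2 ^ (card A - 1)"
      using 3 by (simp add: mult_2[symmetric] power_Suc[symmetric] Suc_diff_le del: power_Suc)
    finally show ?thesis .
  qed
qed

section \<open>Permutations that avoid two patterns at once\<close>

definition avoids_123_132 :: "nat list \<Rightarrow> bool" where
  "avoids_123_132 xs \<longleftrightarrow> avoids xs [1, 2, 3] \<and> avoids xs [1, 3, 2]"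

definition avoids_132_312 :: "nat list \<Rightarrow> bool" where
  "avoids_132_312 xs \<longleftrightarrow> avoids xs [1, 3, 2] \<and> avoids xs [3, 1, 2]"

text \<open>An entry followed by two larger ones starts a 123 or a 132, depending on the order of
  those two. This makes the condition on the head of a word independent of the order of its
  tail.\<close>

lemma avoids_123_132_iff: "avoids_123_132 xs \<longleftrightarrow> triples (\<lambda>x y z. \<not> (x < y \<and> x < z)) xs"
  unfolding avoids_123_132_def avoids_iffs triples_conj[symmetric]
  by (rule arg_cong[of _ _ "\<lambda>R. triples R xs"]) (auto simp: fun_eq_iff)

text \<open>Both patterns end in their middle value, so the last entry of a triple must not lie
  between the other two. Distinctness turns the weak inequalities into strict ones.\<close>

lemma avoids_132_312_iff:
  assumes "distinct xs"
  shows "avoids_132_312 xs \<longleftrightarrow> triples (\<lambda>x y z. \<not> (x < z \<and> z < y) \<and> \<not> (y < z \<and> z < x)) xs"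
proof -
  have neq: "xs ! i \<noteq> xs ! k" "xs ! j \<noteq> xs ! k" if "i < j" "j < k" "k < length xs" for i j k
    using assms that by (simp_all add: nth_eq_iff_index_eq)
  have "\<not> (xs ! i < xs ! k \<and> xs ! k \<le> xs ! j) \<and> \<not> (xs ! j < xs ! k \<and> xs ! k \<le> xs ! i) \<longleftrightarrow>
      \<not> (xs ! i < xs ! k \<and> xs ! k < xs ! j) \<and> \<not> (xs ! j < xs ! k \<and> xs ! k < xs ! i)"
    if "i < j" "j < k" "k < length xs" for i j k
    using neq[OF that] by (simp add: le_less)
  then show ?thesis
    unfolding avoids_132_312_def avoids_iffs triples_conj[symmetric]
    unfolding triples_iff_nth
    by (intro iff_allI imp_cong refl)
qed

lemma two_largest:
  fixes A :: "nat set"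
  assumes "finite A" "card A \<ge> 2"
  obtains a b where "a \<in> A" "b \<in> A" "b < a" "\<And>x. x \<in> A \<Longrightarrow> x = a \<or> x = b \<or> x < b"
proof -
  let ?a = "Max A" and ?b = "Max (A - {Max A})"
  have "A \<noteq> {}"
    using assms by auto
  then have a: "?a \<in> A" "\<And>x. x \<in> A \<Longrightarrow> x \<le> ?a"
    using assms by auto
  have "card (A - {?a}) \<noteq> 0"
    using assms a by simp
  then have "A - {?a} \<noteq> {}"
    by (metis card.empty)
  then have b: "?b \<in> A - {?a}"
    using assms by (intro Max_in) auto
  have "x = ?a \<or> x = ?b \<or> x < ?b" if "x \<in> A" for x
  proof (cases "x = ?a")
    case False
    then have "x \<le> ?b"
      using that assms by (intro Max_ge) auto
    then show ?thesis by linarith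
  qed simp
  then show ?thesis
    using a b by (intro that[of ?a ?b]) (auto simp: less_le)
qed

text \<open>Which of \<open>x\<close> and \<open>y\<close> occurs first is unknown, hence the
  disjunction. It is applied to symmetric relations, for which both disjuncts say the same.\<close>

lemma sorted_wrt_pairwise:
  assumes "sorted_wrt P xs" "x \<in> set xs" "y \<in> set xs" "x \<noteq> y"
  shows "P x y \<or> P y x"
  using assms by (induction xs) auto

lemma sorted_wrt_none_or_one:
  assumes "distinct xs" "\<And>x. x \<in> set xs \<Longrightarrow> P x \<Longrightarrow> x = c"
  shows "sorted_wrt (\<lambda>x y. \<not> (P x \<and> P y)) xs"
  using assms by (induction xs) auto

text \<open>A head may have at most one larger value after it, so it is one of the two largest
  elements of the set.\<close>

lemma card_avoids_123_132:
  assumes "finite A"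
  shows "card {xs \<in> permutations_of_set A. avoids_123_132 xs} = 2 ^ (card A - 1)"
proof (rule card_permutations_two_heads[OF assms])
  fix A :: "nat set"
  assume A: "finite A" "card A \<ge> 2"
  then obtain a b where ab: "a \<in> A" "b \<in> A" "b < a"
    and max: "\<And>x. x \<in> A \<Longrightarrow> x = a \<or> x = b \<or> x < b"
    using two_largest by metis
  have "sorted_wrt (\<lambda>y z. \<not> (x < y \<and> x < z)) xs \<longleftrightarrow> x = a \<or> x = b"
    if x: "x \<in> A" and xs: "xs \<in> permutations_of_set (A - {x})" for x xs
  proof
    assume "sorted_wrt (\<lambda>y z. \<not> (x < y \<and> x < z)) xs"
    \<comment> \<open>Were \<open>x\<close> neither \<open>a\<close> nor \<open>b\<close>, both
      would remain in \<open>xs\<close> and exceed \<open>x\<close>.\<close>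
    from sorted_wrt_pairwise[OF this, of a b] show "x = a \<or> x = b"
      using ab max[OF x] xs by (auto dest: permutations_of_setD)
  next
    assume "x = a \<or> x = b"
    then have "y = a" if "y \<in> A" "x < y" for y
      using max[OF that(1)] that(2) ab by auto
    then show "sorted_wrt (\<lambda>y z. \<not> (x < y \<and> x < z)) xs"
      using xs by (intro sorted_wrt_none_or_one[of _ _ a]) (auto dest: permutations_of_setD)
  qed
  then show "\<exists>a\<in>A. \<exists>b\<in>A. a \<noteq> b \<and> (\<forall>x\<in>A. \<forall>xs\<in>permutations_of_set (A - {x}).
      avoids_123_132 (x # xs) \<longleftrightarrow> (x = a \<or> x = b) \<and> avoids_123_132 xs)"
    using ab by (intro bexI[of _ a] bexI[of _ b]) (auto simp: avoids_123_132_iff)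
qed (simp_all add: avoids_123_132_iff)

text \<open>Here it is the last entry that is restricted: no two earlier entries may lie on opposite
  sides of it, so it is the minimum or the maximum. Reversing the words makes it the head, as the
  counting lemma requires.\<close>

lemma card_avoids_132_312:
  assumes "finite A"
  shows "card {xs \<in> permutations_of_set A. avoids_132_312 xs} = 2 ^ (card A - 1)"
proof -
  define Q :: "nat list \<Rightarrow> bool"
    where "Q = triples (\<lambda>x y z. \<not> (z < x \<and> x < y) \<and> \<not> (y < x \<and> x < z))"
  have iff: "avoids_132_312 (rev xs) \<longleftrightarrow> Q xs" if "distinct xs" for xs
    using that by (simp add: avoids_132_312_iff triples_rev Q_def)
  have "{xs \<in> permutations_of_set A. avoids_132_312 xs} = rev ` {xs \<in> permutations_of_set A. Q xs}"
  proof (intro equalityI subsetI)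
    fix xs
    assume "xs \<in> {xs \<in> permutations_of_set A. avoids_132_312 xs}"
    then have "rev xs \<in> {xs \<in> permutations_of_set A. Q xs}"
      using iff[of "rev xs"] by (auto simp: permutations_of_set_def)
    then show "xs \<in> rev ` {xs \<in> permutations_of_set A. Q xs}"
      by (metis imageI rev_rev_ident)
  qed (auto simp: permutations_of_set_def iff)
  then have "card {xs \<in> permutations_of_set A. avoids_132_312 xs} =
      card {xs \<in> permutations_of_set A. Q xs}"
    by (simp add: card_image)
  also have "\<dots> = 2 ^ (card A - 1)"
  proof (rule card_permutations_two_heads[OF assms])
    fix A :: "nat set"
    assume A: "finite A" "card A \<ge> 2"
    then have ne: "A \<noteq> {}"
      by auto
    have neq: "Min A \<noteq> Max A"
    proof
      assume eq: "Min A = Max A"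
      have "x = Max A" if "x \<in> A" for x
        using eq Min_le[OF A(1) that] Max_ge[OF A(1) that] by simp
      then have "A \<subseteq> {Max A}"
        by auto
      then show False
        using A card_mono[of "{Max A}" A] by simp
    qed
    have "sorted_wrt (\<lambda>y z. \<not> (z < x \<and> x < y) \<and> \<not> (y < x \<and> x < z)) xs \<longleftrightarrow>
        x = Min A \<or> x = Max A"
      if x: "x \<in> A" and xs: "xs \<in> permutations_of_set (A - {x})" for x xs
    proof
      note set_xs = permutations_of_setD(1)[OF xs]
      assume "sorted_wrt (\<lambda>y z. \<not> (z < x \<and> x < y) \<and> \<not> (y < x \<and> x < z)) xs"
      \<comment> \<open>Were \<open>x\<close> neither extreme, both extremes would occur in
        \<open>xs\<close>, on opposite sides of \<open>x\<close>.\<close>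
      from sorted_wrt_pairwise[OF this, of "Min A" "Max A"] show "x = Min A \<or> x = Max A"
        using Min_in[OF A(1) ne] Max_in[OF A(1) ne] neq Min_le[OF A(1) x] Max_ge[OF A(1) x]
        by (auto simp: set_xs less_le simp del: Min_in Max_in)
    next
      note set_xs = permutations_of_setD(1)[OF xs]
      assume "x = Min A \<or> x = Max A"
      then show "sorted_wrt (\<lambda>y z. \<not> (z < x \<and> x < y) \<and> \<not> (y < x \<and> x < z)) xs"
        using Min_le[OF A(1)] Max_ge[OF A(1)]
        by (intro all_sorted_wrt_trivial) (fastforce simp: set_xs not_less)
    qed
    then show "\<exists>a\<in>A. \<exists>b\<in>A. a \<noteq> b \<and> (\<forall>x\<in>A. \<forall>xs\<in>permutations_of_set (A - {x}).
        Q (x # xs) \<longleftrightarrow> (x = a \<or> x = b) \<and> Q xs)"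
      using A ne neq by (intro bexI[of _ "Min A"] bexI[of _ "Max A"]) (auto simp: Q_def)
  qed (simp_all add: Q_def)
  finally show ?thesis .
qed

section \<open>The shape of a permutation with first entry \<open>k\<close>\<close>

lemma sorted_wrt_eq_filter_append:
  assumes "sorted_wrt (\<lambda>x y. P y \<longrightarrow> P x) xs"
  shows "xs = filter P xs @ filter (\<lambda>x. \<not> P x) xs"
  using assms
proof (induction xs)
  case (Cons x xs)
  then have IH: "filter P xs @ filter (\<lambda>x. \<not> P x) xs = xs"
    by simp
  show ?case
  proof (cases "P x")
    case False
    with Cons.prems have "filter P xs = []"
      by (auto simp: filter_empty_conv)
    with False IH show ?thesis by simp
  qed (simp add: IH)
qed simp

lemma sorted_wrt_less_eq_upt:
  assumes "sorted_wrt (\<le>) xs" "distinct xs" "set xs = {m..<n}"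
  shows "xs = [m..<n]"
  using assms by (intro sorted_distinct_set_unique) auto

text \<open>Two later entries above \<open>k\<close> that increase form a 123 with the leading
  \<open>k\<close>; an entry below \<open>k\<close> before one above forms a 132 with the trailing
  \<open>k\<close>. Since \<open>w\<close> is part of both words, it inherits avoidance of 123 from
  the first and of 132 from the second, and so does its lower block \<open>u\<close>.\<close>

lemma avoids_123_rotate_132_iff:
  assumes w: "w \<in> permutations_of_set ({1..n} - {k})" and k: "k \<in> {1..n}"
  shows "avoids (k # w) [1, 2, 3] \<and> avoids (w @ [k]) [1, 3, 2] \<longleftrightarrow>
    (\<exists>u\<in>permutations_of_set {1..<k}. avoids_123_132 u \<and> w = rev [Suc k..<Suc n] @ u)"
    (is "?L \<longleftrightarrow> ?R")
proof
  have w': "set w = {1..n} - {k}" "distinct w"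
    using w by (auto dest: permutations_of_setD)
  assume L: ?L
  define h u where "h = filter (\<lambda>x. k < x) w" and "u = filter (\<lambda>x. \<not> k < x) w"
  have set_h: "set h = {Suc k..<Suc n}" and set_u: "set u = {1..<k}"
    unfolding h_def u_def set_filter w'(1) using k by auto
  have distinct_hu: "distinct h" "distinct u"
    unfolding h_def u_def using w'(2) by simp_all
  have "sorted_wrt (\<lambda>x y. \<not> (x < k \<and> k \<le> y)) w"
    using L unfolding avoids_iffs by (simp add: triples_append)
  then have "sorted_wrt (\<lambda>x y. k < y \<longrightarrow> k < x) w"
    \<comment> \<open>As \<open>k\<close> does not occur in \<open>w\<close>, an entry that is not
      below \<open>k\<close> is strictly above it.\<close>
    by (rule sorted_wrt_mono_rel[rotated]) (simp add: w', linarith)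
  then have w_eq: "w = h @ u"
    unfolding h_def u_def by (rule sorted_wrt_eq_filter_append)
  have "sorted_wrt (\<lambda>x y. \<not> (k < x \<and> x < y)) h"
    using L unfolding w_eq avoids_iffs by (simp add: sorted_wrt_append)
  then have "sorted_wrt (\<lambda>x y. y \<le> x) h"
    by (rule sorted_wrt_mono_rel[rotated]) (simp add: set_h)
  then have "sorted_wrt (\<le>) (rev h)"
    by (simp only: sorted_wrt_rev)
  then have "rev h = [Suc k..<Suc n]"
    by (rule sorted_wrt_less_eq_upt) (simp_all only: set_rev distinct_rev set_h distinct_hu)
  then have "h = rev [Suc k..<Suc n]"
    by (metis rev_rev_ident)
  moreover have "u \<in> permutations_of_set {1..<k}"
    using set_u distinct_hu(2) by (rule permutations_of_setI)
  moreover have "avoids_123_132 u"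
    using L unfolding w_eq avoids_123_132_def avoids_iffs by (simp add: triples_append)
  ultimately show ?R
    using w_eq by blast
next
  assume ?R
  then obtain u where u: "set u = {1..<k}" "avoids_123_132 u"
    and w_eq: "w = rev [Suc k..<Suc n] @ u"
    by (auto dest: permutations_of_setD)
  define h where "h = rev [Suc k..<Suc n]"
  have h: "set h = {k<..n}" "sorted_wrt (>) h"
    by (auto simp: h_def sorted_wrt_rev simp del: upt_Suc)
  have "triples (\<lambda>x y z. \<not> (x < y \<or> x < z)) h"
    \<comment> \<open>The first entry of a triple in the decreasing block exceeds both later ones,
      which excludes 123 and 132 together.\<close>
    using h(2) by (induction h) (auto intro!: all_sorted_wrt_trivial)
  then have "triples (\<lambda>x y z. \<not> (x < y \<and> y < z)) h"
      "triples (\<lambda>x y z. \<not> (x < z \<and> z \<le> y)) h"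
    by (auto elim!: triples_mono)
  moreover have "sorted_wrt (\<lambda>x y. \<not> (k < x \<and> x < y)) h"
    by (rule sorted_wrt_mono_rel[OF _ h(2)]) auto
  ultimately show ?L
    \<comment> \<open>The remaining triples meet both blocks or contain \<open>k\<close>. They are
      settled by the values of \<open>u\<close> lying below \<open>k\<close> and those of
      \<open>h\<close> above it, together with the decrease of \<open>h\<close>.\<close>
    using u unfolding w_eq h_def[symmetric] avoids_123_132_def avoids_iffs
    by (auto simp: triples_append sorted_wrt_append h(1) intro!: all_sorted_wrt_trivial)
qed

text \<open>Two later entries above \<open>k\<close> that decrease form a 132 with the leading
  \<open>k\<close>; an entry above \<open>k\<close> before one below forms a 312 with the trailing
  \<open>k\<close>. Avoidance of 132 passes to \<open>u\<close> from \<open>k # w\<close>, avoidance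
  of 312 from \<open>w @ [k]\<close>.\<close>

lemma avoids_132_rotate_312_iff:
  assumes w: "w \<in> permutations_of_set ({1..n} - {k})" and k: "k \<in> {1..n}"
  shows "avoids (k # w) [1, 3, 2] \<and> avoids (w @ [k]) [3, 1, 2] \<longleftrightarrow>
    (\<exists>u\<in>permutations_of_set {1..<k}. avoids_132_312 u \<and> w = u @ [Suc k..<Suc n])"
    (is "?L \<longleftrightarrow> ?R")
proof
  have w': "set w = {1..n} - {k}" "distinct w"
    using w by (auto dest: permutations_of_setD)
  assume L: ?L
  define u h where "u = filter (\<lambda>x. x < k) w" and "h = filter (\<lambda>x. \<not> x < k) w"
  have set_h: "set h = {Suc k..<Suc n}" and set_u: "set u = {1..<k}"
    unfolding h_def u_def set_filter w'(1) using k by auto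
  have distinct_hu: "distinct h" "distinct u"
    unfolding h_def u_def using w'(2) by simp_all
  have "sorted_wrt (\<lambda>x y. \<not> (y < k \<and> k \<le> x)) w"
    using L unfolding avoids_iffs by (simp add: triples_append)
  then have "sorted_wrt (\<lambda>x y. y < k \<longrightarrow> x < k) w"
    by (rule sorted_wrt_mono_rel[rotated]) (simp add: w', linarith)
  then have w_eq: "w = u @ h"
    unfolding h_def u_def by (rule sorted_wrt_eq_filter_append)
  have "sorted_wrt (\<lambda>x y. \<not> (k < y \<and> y \<le> x)) h"
    using L unfolding w_eq avoids_iffs by (simp add: sorted_wrt_append)
  then have "sorted_wrt (\<lambda>x y. x \<le> y) h"
    by (rule sorted_wrt_mono_rel[rotated]) (simp add: set_h)
  then have "h = [Suc k..<Suc n]"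
    by (rule sorted_wrt_less_eq_upt) (simp_all only: set_h distinct_hu)
  moreover have "u \<in> permutations_of_set {1..<k}"
    using set_u distinct_hu(2) by (rule permutations_of_setI)
  moreover have "avoids_132_312 u"
    using L unfolding w_eq avoids_132_312_def avoids_iffs by (simp add: triples_append)
  ultimately show ?R
    using w_eq by blast
next
  assume ?R
  then obtain u where u: "set u = {1..<k}" "avoids_132_312 u"
    and w_eq: "w = u @ [Suc k..<Suc n]"
    by (auto dest: permutations_of_setD)
  define h where "h = [Suc k..<Suc n]"
  have h: "set h = {k<..n}" "sorted_wrt (<) h"
    by (auto simp: h_def simp del: upt_Suc)
  have "triples (\<lambda>x y z. x < y \<and> y < z) h"
    using h(2)
  proof (induction h)
    case (Cons x h)
    then show ?case
      by (auto intro: sorted_wrt_mono_rel[of h "(<)"])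
  qed simp
  then have "triples (\<lambda>x y z. \<not> (x < z \<and> z \<le> y)) h"
      "triples (\<lambda>x y z. \<not> (y < z \<and> z \<le> x)) h"
    by (auto elim!: triples_mono)
  \<comment> \<open>Since \<open>h\<close> increases, this holds for any \<open>x\<close>; it covers
    triples whose last two entries lie in \<open>h\<close> and whose first is \<open>k\<close> or an
    entry of \<open>u\<close>.\<close>
  moreover have "sorted_wrt (\<lambda>y z. \<not> (x < z \<and> z \<le> y)) h" for x
    by (rule sorted_wrt_mono_rel[OF _ h(2)]) auto
  ultimately show ?L
    using u unfolding w_eq h_def[symmetric] avoids_132_312_def avoids_iffs
    by (auto simp: triples_append sorted_wrt_append h(1) intro!: all_sorted_wrt_trivial)
qed

section \<open>Summation over the first entry\<close>

lemma sum_two_power_pred_pred: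
  assumes "n \<ge> 1"
  shows "(\<Sum>k = 1..n. 2 ^ (k - 1 - 1)) = (2 :: nat) ^ (n - 1)"
  using assms
\<comment> \<open>By truncated subtraction the exponents are 0, 0, 1, 2, and so on:
  \<open>k = 1\<close> and \<open>k = 2\<close> both contribute 1, and from then on each new term
  equals the sum of all earlier ones.\<close>
proof (induction n rule: dec_induct)
  case (step n)
  then obtain m where "n = Suc m"
    by (cases n) auto
  with step.IH show ?case by simp
qed simp

text \<open>The counting step shared by both pairs of patterns. A permutation is encoded by its
  first entry \<open>k\<close> and the word \<open>u\<close> on the values below \<open>k\<close>;
  \<open>g k\<close> adds the larger values in their forced arrangement. The code is unique because
  \<open>k\<close> is the head and \<open>g k\<close> is injective.\<close>

lemma card_by_first_entry:
  assumes "n \<ge> 1"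
    and iff: "\<And>k w. k \<in> {1..n} \<Longrightarrow> w \<in> permutations_of_set ({1..n} - {k}) \<Longrightarrow>
      Q (k # w) \<longleftrightarrow> (\<exists>u\<in>permutations_of_set {1..<k}. S u \<and> w = g k u)"
    and g: "\<And>k u. k \<in> {1..n} \<Longrightarrow> u \<in> permutations_of_set {1..<k} \<Longrightarrow>
      g k u \<in> permutations_of_set ({1..n} - {k})"
    and inj: "\<And>k. inj (g k)"
    and card_S: "\<And>k. card {u \<in> permutations_of_set {1..<k}. S u} = 2 ^ (card {1..<k} - 1)"
  shows "card {p \<in> permutations_of_set {1..n :: nat}. Q p} = 2 ^ (n - 1)"
proof -
  let ?U = "\<lambda>k. {u \<in> permutations_of_set {1..<k}. S u}"
  have "{p \<in> permutations_of_set {1..n}. Q p} = (\<lambda>(k, u). k # g k u) ` Sigma {1..n} ?U"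
  proof (intro equalityI subsetI)
    fix p
    assume "p \<in> {p \<in> permutations_of_set {1..n}. Q p}"
    then obtain k w where kw: "p = k # w" "k \<in> {1..n}"
        "w \<in> permutations_of_set ({1..n} - {k})" "Q (k # w)"
      using assms(1) by (auto simp: permutations_of_set_nonempty)
    then obtain u where "u \<in> ?U k" "w = g k u"
      using iff by blast
    with kw show "p \<in> (\<lambda>(k, u). k # g k u) ` Sigma {1..n} ?U"
      by force
  next
    fix p
    assume "p \<in> (\<lambda>(k, u). k # g k u) ` Sigma {1..n} ?U"
    then obtain k u where ku: "p = k # g k u" "k \<in> {1..n}" "u \<in> ?U k"
      by auto
    moreover from this have "g k u \<in> permutations_of_set ({1..n} - {k})"
      using g by simp
    ultimately show "p \<in> {p \<in> permutations_of_set {1..n}. Q p}"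
      using iff[of k "g k u"] by (auto simp: permutations_of_set_nonempty)
  qed
  moreover have "inj_on (\<lambda>(k, u). k # g k u) (Sigma {1..n} ?U)"
    using inj by (auto simp: inj_on_def)
  ultimately have "card {p \<in> permutations_of_set {1..n}. Q p} = (\<Sum>k = 1..n. card (?U k))"
    by (simp add: card_image)
  also have "\<dots> = (\<Sum>k = 1..n. 2 ^ (k - 1 - 1))"
    by (simp only: card_S card_atLeastLessThan)
  also have "\<dots> = 2 ^ (n - 1)"
    by (rule sum_two_power_pred_pred[OF assms(1)])
  finally show ?thesis .
qed

theorem proposition5p2:
  fixes n :: nat
  assumes "n \<ge> 2"
  shows "card (avoid_pair n [1, 2, 3] [1, 3, 2]) = 2 ^ (n - 1) \<and>
         card (avoid_pair n [1, 3, 2] [3, 1, 2]) = 2 ^ (n - 1)"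
proof
  have n: "n \<ge> 1"
    using assms by simp
  show "card (avoid_pair n [1, 2, 3] [1, 3, 2]) = 2 ^ (n - 1)"
    unfolding avoid_pair_def perms_def
  \<comment> \<open>The values above \<open>k\<close> form a decreasing prefix, empty when
    \<open>k = n\<close>.\<close>
  proof (rule card_by_first_entry[OF n, where S = avoids_123_132
        and g = "\<lambda>k u. rev [Suc k..<Suc n] @ u"])
    fix k w
    assume "k \<in> {1..n}" "w \<in> permutations_of_set ({1..n} - {k})"
    from avoids_123_rotate_132_iff[OF this(2,1)]
    show "avoids (k # w) [1, 2, 3] \<and> avoids (rotate1 (k # w)) [1, 3, 2] \<longleftrightarrow>
        (\<exists>u\<in>permutations_of_set {1..<k}. avoids_123_132 u \<and> w = rev [Suc k..<Suc n] @ u)"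
      by (simp only: rotate1.simps)
  next
    show "card {u \<in> permutations_of_set {1..<k}. avoids_123_132 u} = 2 ^ (card {1..<k} - 1)" for k
      by (rule card_avoids_123_132) simp
  next
    fix k u
    assume k: "k \<in> {1..n}" and u: "u \<in> permutations_of_set {1..<k}"
    have "{1..<k} \<union> {Suc k..<Suc n} = {1..n} - {k}"
      using k by auto
    then show "rev [Suc k..<Suc n] @ u \<in> permutations_of_set ({1..n} - {k})"
      using permutations_of_setD[OF u]
      by (intro permutations_of_setI) (simp_all add: Un_commute del: upt_Suc)
  qed (simp add: inj_def)
  show "card (avoid_pair n [1, 3, 2] [3, 1, 2]) = 2 ^ (n - 1)"
    unfolding avoid_pair_def perms_def
  \<comment> \<open>Now the values above \<open>k\<close> form an increasing suffix.\<close>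
  proof (rule card_by_first_entry[OF n, where S = avoids_132_312
        and g = "\<lambda>k u. u @ [Suc k..<Suc n]"])
    fix k w
    assume "k \<in> {1..n}" "w \<in> permutations_of_set ({1..n} - {k})"
    from avoids_132_rotate_312_iff[OF this(2,1)]
    show "avoids (k # w) [1, 3, 2] \<and> avoids (rotate1 (k # w)) [3, 1, 2] \<longleftrightarrow>
        (\<exists>u\<in>permutations_of_set {1..<k}. avoids_132_312 u \<and> w = u @ [Suc k..<Suc n])"
      by (simp only: rotate1.simps)
  next
    show "card {u \<in> permutations_of_set {1..<k}. avoids_132_312 u} = 2 ^ (card {1..<k} - 1)" for k
      by (rule card_avoids_132_312) simp
  next
    fix k u
    assume k: "k \<in> {1..n}" and u: "u \<in> permutations_of_set {1..<k}"
    have "{1..<k} \<union> {Suc k..<Suc n} = {1..n} - {k}"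
      using k by auto
    then show "u @ [Suc k..<Suc n] \<in> permutations_of_set ({1..n} - {k})"
      using permutations_of_setD[OF u]
      by (intro permutations_of_setI) (simp_all add: Un_commute del: upt_Suc)
  qed (simp add: inj_def)
qed

end
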